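(* Let $0<q\le 1$. There exists a constant $C>0$ such that, for any integer $d\ge1$ and any $r,\sigma>0$, $$\sup_{\theta\in B_q(r)} \mathbf E_\theta\big(\hat L_q - L(\theta)\big)^2 \le C\,\psi^L_{\sigma,q}(r,d).$$
   Context: Model: one observes $y_j=\theta_j+\sigma\xi_j$, $j=1,\dots,d$, where $\theta=(\theta_1,\dots,\theta_d)\in\mathbb R^d$ is unknown, $\xi_1,\dots,\xi_d$ are i.i.d. standard normal and $\sigma>0$. $\mathbf P_\theta$ is the law of $(y_1,\dots,y_d)$ and $\mathbf E_\theta$ the corresponding expectation. $L(\theta)=\sum_{i=1}^d\theta_i$; $\|\theta\|_q=\big(\sum_{i=1}^d|\theta_i|^q\big)^{1/q}$; $B_q(r)=\{\theta\in\mathbb R^d:\|\theta\|_q\le r\}$. The integer $m=m(d,r,\sigma,q)$ is $$m=\max\{s\in\{1,\dots,d\}:\ \sigma^2\log(1+d/s^2)\le r^2s^{-2/q}\}$$ if this set is non-empty, and $m=0$ otherwise. The rate is $$\psi^L_{\sigma,q}(r,d)=\begin{cases}\sigma^2m^2\log(1+d/m^2)&\text{if } m\ge1,\\ r^2&\text{if } m=0.\end{cases}$$ The estimator is $$\hat L_q=\begin{cases}\sum_{j=1}^d y_j&\text{if } m>\sqrt d,\\ \sum_{j=1}^d y_j\,\mathbf 1_{\{|y_j|>2\sigma\sqrt{2\log(1+d/m^2)}\}}&\text{if } 1\le m\le\sqrt d,\\ 0&\text{if } m=0.\end{cases}$$ *)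

theory Defs
  imports "HOL-Probability.Probability"
begin

text \<open>
  The dimension \<open>d\<close> is quantified inside the statement (the constant must not depend on it), so a
  point of \<open>\<real>\<^sup>d\<close> is a function \<open>nat \<Rightarrow> real\<close> in \<open>extensional {1..d}\<close>, i.e. with coordinates indexed
  by \<open>{1..d}\<close> and the value \<open>undefined\<close> elsewhere. This is the carrier of the product measures \<open>Pi\<^sub>M {1..d} M\<close>.
\<close>

definition noise_measure :: "nat \<Rightarrow> (nat \<Rightarrow> real) measure" where
  "noise_measure d = (\<Pi>\<^sub>M j\<in>{1..d}. density lborel (\<lambda>x. ennreal (std_normal_density x)))"

text \<open>The law of \<open>y\<^sub>j = \<theta>\<^sub>j + \<sigma> \<xi>\<^sub>j\<close>, with \<open>\<xi>\<close> distributed as \<^term>\<open>noise_measure d\<close>.\<close>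

definition obs_law :: "nat \<Rightarrow> real \<Rightarrow> (nat \<Rightarrow> real) \<Rightarrow> (nat \<Rightarrow> real) measure" where
  "obs_law d \<sigma> \<theta> =
     distr (noise_measure d) (\<Pi>\<^sub>M j\<in>{1..d}. borel) (\<lambda>\<xi>. \<lambda>j\<in>{1..d}. \<theta> j + \<sigma> * \<xi> j)"

definition lin_functional :: "nat \<Rightarrow> (nat \<Rightarrow> real) \<Rightarrow> real" where
  "lin_functional d \<theta> = (\<Sum>i=1..d. \<theta> i)"

definition lq_norm :: "nat \<Rightarrow> real \<Rightarrow> (nat \<Rightarrow> real) \<Rightarrow> real" where
  "lq_norm d q \<theta> = (\<Sum>i=1..d. \<bar>\<theta> i\<bar> powr q) powr (1 / q)"

definition lq_ball :: "nat \<Rightarrow> real \<Rightarrow> real \<Rightarrow> (nat \<Rightarrow> real) set" where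
  "lq_ball d q r = {\<theta> \<in> extensional {1..d}. lq_norm d q \<theta> \<le> r}"

definition m_set :: "nat \<Rightarrow> real \<Rightarrow> real \<Rightarrow> real \<Rightarrow> nat set" where
  "m_set d r \<sigma> q =
     {s \<in> {1..d}. \<sigma>\<^sup>2 * ln (1 + real d / (real s)\<^sup>2) \<le> r\<^sup>2 * real s powr (- 2 / q)}"

definition m_index :: "nat \<Rightarrow> real \<Rightarrow> real \<Rightarrow> real \<Rightarrow> nat" where
  "m_index d r \<sigma> q = (if m_set d r \<sigma> q = {} then 0 else Max (m_set d r \<sigma> q))"

definition rate :: "real \<Rightarrow> real \<Rightarrow> real \<Rightarrow> nat \<Rightarrow> real" where
  "rate \<sigma> q r d =
     (let m = m_index d r \<sigma> q in
      if m \<ge> 1 then \<sigma>\<^sup>2 * (real m)\<^sup>2 * ln (1 + real d / (real m)\<^sup>2) else r\<^sup>2)"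

definition estimator :: "nat \<Rightarrow> real \<Rightarrow> real \<Rightarrow> real \<Rightarrow> (nat \<Rightarrow> real) \<Rightarrow> real" where
  "estimator d r \<sigma> q y =
     (let m = m_index d r \<sigma> q in
      if real m > sqrt (real d) then (\<Sum>j=1..d. y j)
      else if m \<ge> 1 then
        (\<Sum>j=1..d. y j * of_bool (\<bar>y j\<bar> > 2 * \<sigma> * sqrt (2 * ln (1 + real d / (real m)\<^sup>2))))
      else 0)"

text \<open>
  The squared risk is a Lebesgue integral with values in \<open>[0, \<infinity>]\<close>, so that a finite bound on it (and
  on its supremum) asserts finiteness; the real-valued integral and supremum have arbitrary default
  values in the infinite case.
\<close>

definition risk :: "nat \<Rightarrow> real \<Rightarrow> real \<Rightarrow> real \<Rightarrow> (nat \<Rightarrow> real) \<Rightarrow> ennreal" where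
  "risk d r \<sigma> q \<theta> =
     (\<integral>\<^sup>+ y. ennreal ((estimator d r \<sigma> q y - lin_functional d \<theta>)\<^sup>2) \<partial>obs_law d \<sigma> \<theta>)"

end

theory Submission
  imports Defs
begin

text \<open>
  The coordinates are independent, so the risk is the sum of the coordinatewise variances plus the
  square of the summed bias. Let \<open>1 \<le> m \<le> \<surd>d\<close>, \<open>L = ln (1 + d/m\<^sup>2)\<close>, and let \<open>2s\<close> be the threshold, with
  \<open>s = \<sigma> \<surd>(2L)\<close>. Maximality of \<open>m\<close> bounds the number of coordinates with \<open>\<bar>\<theta>\<^sub>j\<bar> > s\<close> by \<open>m + 1\<close> and the
  \<open>l\<^sub>1\<close> norm of the other coordinates by \<open>(m + 1) s\<close>. A large coordinate has bias at most \<open>2s\<close> and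
  variance \<open>O(\<sigma>\<^sup>2 L)\<close>. At a small coordinate the threshold is exceeded only if \<open>\<sigma>\<bar>\<xi>\<^sub>j\<bar> > s\<close>, so the variance
  is \<open>O(\<sigma>\<^sup>2 L exp (-L)) = O(\<sigma>\<^sup>2 L m\<^sup>2/d)\<close>, and symmetry of the noise makes the bias \<open>O(\<bar>\<theta>\<^sub>j\<bar>)\<close>. For \<open>m > \<surd>d\<close> the
  risk is \<open>\<sigma>\<^sup>2 d\<close>, and for \<open>m = 0\<close> it is \<open>(\<Sum>\<^sub>j \<theta>\<^sub>j)\<^sup>2 \<le> r\<^sup>2\<close> because the \<open>l\<^sub>1\<close> norm is at most the \<open>l\<^sub>q\<close> norm.
\<close>

section \<open>Second moment of a sum of functions of independent coordinates\<close>

lemma nn_integral_PiM_sum_square: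
  fixes g :: "'i \<Rightarrow> 'a \<Rightarrow> real"
  assumes "prob_space M" "finite I"
    and meas: "\<And>i. i \<in> I \<Longrightarrow> g i \<in> borel_measurable M"
    and sq: "\<And>i. i \<in> I \<Longrightarrow> integrable M (\<lambda>x. (g i x)\<^sup>2)"
  shows "(\<integral>\<^sup>+ \<omega>. ennreal ((\<Sum>i\<in>I. g i (\<omega> i))\<^sup>2) \<partial>(\<Pi>\<^sub>M i\<in>I. M)) =
    ennreal ((\<Sum>i\<in>I. (\<integral>x. (g i x)\<^sup>2 \<partial>M) - (\<integral>x. g i x \<partial>M)\<^sup>2) + (\<Sum>i\<in>I. \<integral>x. g i x \<partial>M)\<^sup>2)"
proof -
  interpret M: prob_space M by fact
  interpret P: product_prob_space "\<lambda>_. M" I ..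
  interpret P: product_sigma_finite "\<lambda>_. M" ..
  let ?P = "\<Pi>\<^sub>M i\<in>I. M"
  let ?e = "\<lambda>i. \<integral>x. g i x \<partial>M"
  let ?v = "\<lambda>i j. if i = j then \<integral>x. (g i x)\<^sup>2 \<partial>M else ?e i * ?e j"
  have int: "integrable M (g i)" if "i \<in> I" for i
    using M.square_integrable_imp_integrable meas sq that by blast
  have pair: "has_bochner_integral ?P (\<lambda>\<omega>. g i (\<omega> i) * g j (\<omega> j)) (?v i j)"
    if "i \<in> I" "j \<in> I" for i j
  proof -
    \<comment> \<open>The pair is written as a product over all of \<open>I\<close> with factor 1
      away from \<open>i\<close> and \<open>j\<close>, so that integrals over the product measure
      factorise. For \<open>i = j\<close> both factors sit in the same coordinate and produce the
      square.\<close>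
    define f where "f = (\<lambda>k x. (if k = i then g i x else 1) * (if k = j then g j x else 1))"
    have f_int: "integrable M (f k)" if "k \<in> I" for k
    proof (cases "i = j")
      case True
      then show ?thesis
        using sq[OF \<open>i \<in> I\<close>] by (cases "k = i") (auto simp: f_def power2_eq_square)
    next
      case False
      then show ?thesis
        using int[OF \<open>i \<in> I\<close>] int[OF \<open>j \<in> I\<close>]
        by (cases "k = i"; cases "k = j") (auto simp: f_def)
    qed
    have f_prod: "(\<Prod>k\<in>I. f k (\<omega> k)) = g i (\<omega> i) * g j (\<omega> j)" for \<omega>
    proof -
      have "(\<Prod>k\<in>I. f k (\<omega> k)) =
          (\<Prod>k\<in>I. if k = i then g i (\<omega> k) else 1) * (\<Prod>k\<in>I. if k = j then g j (\<omega> k) else 1)"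
        by (simp add: f_def prod.distrib)
      then show ?thesis
        using \<open>finite I\<close> that by (simp add: prod.delta)
    qed
    have "(\<Prod>k\<in>I. \<integral>x. f k x \<partial>M) = ?v i j"
    proof (cases "i = j")
      case True
      have "(\<Prod>k\<in>I. \<integral>x. f k x \<partial>M) = (\<Prod>k\<in>I. if k = i then \<integral>x. (g i x)\<^sup>2 \<partial>M else 1)"
        using True by (intro prod.cong) (auto simp: f_def power2_eq_square M.prob_space)
      then show ?thesis
        using True \<open>finite I\<close> that by (simp add: prod.delta)
    next
      case False
      have "(\<Prod>k\<in>I. \<integral>x. f k x \<partial>M) =
          (\<Prod>k\<in>I. (if k = i then ?e i else 1) * (if k = j then ?e j else 1))"
        using False by (intro prod.cong) (auto simp: f_def M.prob_space)
      also have "\<dots> = (\<Prod>k\<in>I. if k = i then ?e i else 1) * (\<Prod>k\<in>I. if k = j then ?e j else 1)"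
        by (rule prod.distrib)
      finally show ?thesis
        using False \<open>finite I\<close> that by (simp add: prod.delta)
    qed
    moreover have "integrable ?P (\<lambda>\<omega>. g i (\<omega> i) * g j (\<omega> j))"
      using P.product_integrable_prod[of I f, OF \<open>finite I\<close> f_int] unfolding f_prod .
    moreover have "(\<integral>\<omega>. g i (\<omega> i) * g j (\<omega> j) \<partial>?P) = (\<Prod>k\<in>I. \<integral>x. f k x \<partial>M)"
      using P.product_integral_prod[of I f, OF \<open>finite I\<close> f_int] unfolding f_prod .
    ultimately show ?thesis
      unfolding has_bochner_integral_iff by (simp only: simp_thms)
  qed
  have "has_bochner_integral ?P (\<lambda>\<omega>. \<Sum>i\<in>I. \<Sum>j\<in>I. g i (\<omega> i) * g j (\<omega> j)) (\<Sum>i\<in>I. \<Sum>j\<in>I. ?v i j)"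
    by (intro has_bochner_integral_sum pair)
  moreover have "(\<Sum>i\<in>I. \<Sum>j\<in>I. g i (\<omega> i) * g j (\<omega> j)) = (\<Sum>i\<in>I. g i (\<omega> i))\<^sup>2" for \<omega>
    by (simp add: power2_eq_square sum_product)
  moreover have "(\<Sum>i\<in>I. \<Sum>j\<in>I. ?v i j) =
      (\<Sum>i\<in>I. (\<integral>x. (g i x)\<^sup>2 \<partial>M) - (?e i)\<^sup>2) + (\<Sum>i\<in>I. ?e i)\<^sup>2"
  proof -
    \<comment> \<open>The diagonal entry is split into variance plus squared mean; the squared means
      then complete the off-diagonal products to the square of the summed means.\<close>
    have "(\<Sum>i\<in>I. \<Sum>j\<in>I. ?v i j) =
        (\<Sum>i\<in>I. \<Sum>j\<in>I. (if i = j then (\<integral>x. (g i x)\<^sup>2 \<partial>M) - (?e i)\<^sup>2 else 0) + ?e i * ?e j)"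
      by (intro sum.cong) (auto simp: power2_eq_square)
    also have "\<dots> = (\<Sum>i\<in>I. (\<integral>x. (g i x)\<^sup>2 \<partial>M) - (?e i)\<^sup>2) + (\<Sum>i\<in>I. \<Sum>j\<in>I. ?e i * ?e j)"
      using \<open>finite I\<close> by (simp add: sum.distrib)
    finally show ?thesis
      by (simp add: power2_eq_square sum_product)
  qed
  ultimately have "has_bochner_integral ?P (\<lambda>\<omega>. (\<Sum>i\<in>I. g i (\<omega> i))\<^sup>2)
      ((\<Sum>i\<in>I. (\<integral>x. (g i x)\<^sup>2 \<partial>M) - (?e i)\<^sup>2) + (\<Sum>i\<in>I. ?e i)\<^sup>2)"
    by simp
  then show ?thesis
    by (auto simp: has_bochner_integral_iff nn_integral_eq_integral)
qed

section \<open>Hard thresholding and its symmetries\<close>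

definition hard_threshold :: "real \<Rightarrow> real \<Rightarrow> real" where
  "hard_threshold t u = u * of_bool (t < \<bar>u\<bar>)"

lemma hard_threshold_measurable [measurable]: "hard_threshold t \<in> borel_measurable borel"
  unfolding hard_threshold_def by measurable

text \<open>Used to normalise the noise level: dividing the observation by \<open>\<sigma>\<close>
  reduces all moment estimates to standard normal noise around
  \<open>\<theta> / \<sigma>\<close>.\<close>

lemma hard_threshold_scale:
  assumes "\<sigma> > 0"
  shows "hard_threshold (\<sigma> * t) (\<sigma> * u) = \<sigma> * hard_threshold t u"
  using assms by (auto simp: hard_threshold_def abs_mult)

lemma hard_threshold_minus: "hard_threshold t (- u) = - hard_threshold t u"
  by (simp add: hard_threshold_def)

section \<open>Integrals against the standard normal law\<close>

lemma std_normal_has_moment_2: "has_bochner_integral std_normal_distribution (\<lambda>x. x\<^sup>2) 1"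
  using std_normal_distribution_even_moments[of 1] by (simp add: has_bochner_integral_iff)

lemma std_normal_integrable_quadratic:
  "integrable std_normal_distribution (\<lambda>x. a + b * x\<^sup>2)"
  using std_normal_has_moment_2 by (auto simp: has_bochner_integral_iff
      intro!: Bochner_Integration.integrable_add integrable_mult_right
        finite_measure.integrable_const prob_space.finite_measure prob_space_normal_density)

lemma std_normal_integral_quadratic:
  "(\<integral>x. a + b * x\<^sup>2 \<partial>std_normal_distribution) = a + b"
proof -
  interpret prob_space std_normal_distribution
    by (rule prob_space_normal_density) simp
  show ?thesis
    using std_normal_has_moment_2
    by (subst Bochner_Integration.integral_add) (auto simp: has_bochner_integral_iff prob_space[simplified])
qed

text \<open>The second moment of the noise is 1, so a quadratic majorant settles integrability and
  the size of the integral at once.\<close>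

lemma std_normal_integrable_quadratic_bound:
  assumes "f \<in> borel_measurable borel" and "\<And>x. \<bar>f x\<bar> \<le> a + b * x\<^sup>2"
  shows "integrable std_normal_distribution (f :: real \<Rightarrow> real)"
    "\<bar>\<integral>x. f x \<partial>std_normal_distribution\<bar> \<le> a + b"
proof -
  show int: "integrable std_normal_distribution f"
    using std_normal_integrable_quadratic[of a b]
    by (rule Bochner_Integration.integrable_bound) (use assms in \<open>auto intro: order_trans[OF _ abs_ge_self]\<close>)
  have "\<bar>\<integral>x. f x \<partial>std_normal_distribution\<bar> \<le> (\<integral>x. \<bar>f x\<bar> \<partial>std_normal_distribution)"
    by (rule integral_abs_bound)
  also have "\<dots> \<le> (\<integral>x. a + b * x\<^sup>2 \<partial>std_normal_distribution)"
    using int by (intro integral_mono std_normal_integrable_quadratic assms) auto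
  finally show "\<bar>\<integral>x. f x \<partial>std_normal_distribution\<bar> \<le> a + b"
    by (simp add: std_normal_integral_quadratic)
qed

text \<open>Moving the shift from the integrand to the density makes expectations under different
  centres comparable as integrals of one function over Lebesgue measure.\<close>

lemma std_normal_integral_shift:
  fixes f :: "real \<Rightarrow> real"
  assumes [measurable]: "f \<in> borel_measurable borel"
  shows "(\<integral>x. f (\<theta> + x) \<partial>std_normal_distribution) = (\<integral>y. std_normal_density (y - \<theta>) * f y \<partial>lborel)"
    and "integrable std_normal_distribution (\<lambda>x. f (\<theta> + x)) \<longleftrightarrow>
      integrable lborel (\<lambda>y. std_normal_density (y - \<theta>) * f y)"
  using lborel_integral_real_affine[of 1 "\<lambda>y. std_normal_density (y - \<theta>) * f y" \<theta>]
    lborel_integrable_real_affine_iff[of 1 "\<lambda>y. std_normal_density (y - \<theta>) * f y" \<theta>]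
  by (simp_all add: integral_density integrable_density)

lemma std_normal_integral_reflect:
  fixes f :: "real \<Rightarrow> real"
  assumes [measurable]: "f \<in> borel_measurable borel"
  shows "(\<integral>x. f (- x) \<partial>std_normal_distribution) = (\<integral>x. f x \<partial>std_normal_distribution)"
  using lborel_integral_real_affine[of "- 1" "\<lambda>x. std_normal_density x * f x" 0]
  by (simp add: integral_density normal_density_def)

text \<open>The exponent of the left side contains the cross term \<open>- t * u\<close>, which is
  nonpositive and is dropped.\<close>

lemma std_normal_density_add_le:
  assumes "0 \<le> t * u"
  shows "std_normal_density (t + u) \<le> exp (- t\<^sup>2 / 2) * std_normal_density u"
proof -
  have "exp (- (t + u)\<^sup>2 / 2) \<le> exp (- t\<^sup>2 / 2 + - u\<^sup>2 / 2)"
    using assms by (simp add: power2_sum field_simps)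
  then show ?thesis
    unfolding std_normal_density_def exp_add by (simp add: divide_right_mono)
qed

text \<open>On the right tail put \<open>x = s + u\<close> with \<open>u > 0\<close>: the density is
  at most \<open>exp (- s\<^sup>2 / 2)\<close> times the density at \<open>u\<close>, and
  \<open>x\<^sup>2\<close> is at most \<open>2 * s\<^sup>2 + 2 * u\<^sup>2\<close>. Integrating this
  majorant over all \<open>u\<close> gives \<open>2 * s\<^sup>2 + 2\<close> times the exponential;
  the left tail is its mirror image, whence the factor 4.\<close>

lemma std_normal_tail_second_moment:
  assumes "0 \<le> s"
  shows "(\<integral>x. x\<^sup>2 * of_bool (s < \<bar>x\<bar>) \<partial>std_normal_distribution) \<le> 4 * (1 + s\<^sup>2) * exp (- s\<^sup>2 / 2)"
proof -
  let ?\<phi> = std_normal_density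
  define g where "g = (\<lambda>u. 2 * s\<^sup>2 + 2 * u\<^sup>2 :: real)"
  have [measurable]: "g \<in> borel_measurable borel"
    unfolding g_def by measurable
  have g_shift: "has_bochner_integral lborel (\<lambda>y. ?\<phi> (y - \<theta>) * g (y - \<theta>)) (2 * s\<^sup>2 + 2)" for \<theta>
    using std_normal_integral_shift[of "\<lambda>y. g (y - \<theta>)" \<theta>]
      std_normal_integrable_quadratic[of "2 * s\<^sup>2" 2] std_normal_integral_quadratic[of "2 * s\<^sup>2" 2]
    by (simp add: has_bochner_integral_iff g_def)
  have pos: "?\<phi> x * x\<^sup>2 \<le> exp (- s\<^sup>2 / 2) * (?\<phi> (x - s) * g (x - s))" if "s < x" for x
  proof -
    have "?\<phi> (s + (x - s)) \<le> exp (- s\<^sup>2 / 2) * ?\<phi> (x - s)"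
      by (rule std_normal_density_add_le) (use that assms in auto)
    moreover have "(s + (x - s))\<^sup>2 \<le> g (x - s)"
      unfolding g_def using sum_squares_bound[of s "x - s"] by (simp only: power2_sum)
    ultimately have "?\<phi> x * x\<^sup>2 \<le> (exp (- s\<^sup>2 / 2) * ?\<phi> (x - s)) * g (x - s)"
      by (intro mult_mono) auto
    then show ?thesis
      by (simp only: mult.assoc)
  qed
  have nonneg: "0 \<le> ?\<phi> u * g u" for u
    by (simp add: g_def)
  \<comment> \<open>One majorant for each tail, centred at \<open>s\<close> and at
    \<open>- s\<close>. Both are nonnegative, so on either tail the other one can be
    discarded.\<close>
  let ?bd = "\<lambda>x. exp (- s\<^sup>2 / 2) * (?\<phi> (x - s) * g (x - s) + ?\<phi> (x - - s) * g (x - - s))"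
  have "?\<phi> x * (x\<^sup>2 * of_bool (s < \<bar>x\<bar>)) \<le> ?bd x" for x
  proof -
    consider "s < x" | "s < - x" | "\<not> s < \<bar>x\<bar>" by linarith
    then show ?thesis
    proof cases
      case 1
      then show ?thesis
        using pos[of x] nonneg[of "x + s"] by (auto simp: distrib_left intro: add_increasing2)
    next
      case 2
      have "?\<phi> (- x - s) = ?\<phi> (x + s)" "g (- x - s) = g (x + s)" "?\<phi> (- x) = ?\<phi> x"
        by (simp_all add: std_normal_density_def g_def power2_eq_square algebra_simps)
      then show ?thesis
        using 2 pos[of "- x"] nonneg[of "x - s"] by (auto simp: distrib_left intro: add_increasing)
    next
      case 3
      then show ?thesis
        using nonneg[of "x - s"] nonneg[of "x + s"] by simp
    qed
  qed
  moreover have bd: "has_bochner_integral lborel ?bd (exp (- s\<^sup>2 / 2) * ((2 * s\<^sup>2 + 2) + (2 * s\<^sup>2 + 2)))"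
    by (intro has_bochner_integral_mult_right has_bochner_integral_add g_shift)
  moreover have "integrable std_normal_distribution (\<lambda>x. x\<^sup>2 * of_bool (s < \<bar>x\<bar>))"
    by (rule std_normal_integrable_quadratic_bound[where a = 0 and b = 1]) (auto simp: abs_mult)
  ultimately have "(\<integral>x. ?\<phi> x * (x\<^sup>2 * of_bool (s < \<bar>x\<bar>)) \<partial>lborel) \<le> (\<integral>x. ?bd x \<partial>lborel)"
    by (intro integral_mono) (auto simp: integrable_density has_bochner_integral_iff)
  then show ?thesis
    using bd by (simp add: integral_density has_bochner_integral_iff algebra_simps)
qed

section \<open>Bias and variance of a thresholded normal observation\<close>

text \<open>If \<open>\<theta> + x\<close> passes the threshold although \<open>\<theta>\<close> is
  at most half of it, then the noise exceeds \<open>t / 2\<close>, hence dominates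
  \<open>\<bar>\<theta>\<bar>\<close>, and the observation is at most twice the noise.\<close>

lemma hard_threshold_square_le:
  assumes "\<bar>\<theta>\<bar> \<le> t / 2"
  shows "(hard_threshold t (\<theta> + x))\<^sup>2 \<le> 4 * (x\<^sup>2 * of_bool (t / 2 < \<bar>x\<bar>))"
proof (cases "t < \<bar>\<theta> + x\<bar>")
  case True
  then have "\<bar>\<theta> + x\<bar> \<le> \<bar>2 * x\<bar>" "t / 2 < \<bar>x\<bar>"
    using assms by linarith+
  then have "(\<theta> + x)\<^sup>2 \<le> (2 * x)\<^sup>2"
    by (simp only: abs_le_square_iff)
  then show ?thesis
    using True \<open>t / 2 < \<bar>x\<bar>\<close> by (simp add: hard_threshold_def power_mult_distrib)
qed (simp add: hard_threshold_def)

text \<open>Both bounds integrate the preceding pointwise inequality. Dropping the indicator gives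
  the constant 4, which suffices for the bias; keeping it gives the exponentially small bound needed
  for the variance.\<close>

lemma hard_threshold_second_moment:
  assumes "\<bar>\<theta>\<bar> \<le> t / 2"
  shows "integrable std_normal_distribution (\<lambda>x. (hard_threshold t (\<theta> + x))\<^sup>2)"
    and "(\<integral>x. (hard_threshold t (\<theta> + x))\<^sup>2 \<partial>std_normal_distribution) \<le> 4"
    and "(\<integral>x. (hard_threshold t (\<theta> + x))\<^sup>2 \<partial>std_normal_distribution) \<le>
      16 * (1 + (t / 2)\<^sup>2) * exp (- (t / 2)\<^sup>2 / 2)"
proof -
  let ?N = std_normal_distribution
  let ?tail = "\<lambda>x. 4 * (x\<^sup>2 * of_bool (t / 2 < \<bar>x\<bar>)) :: real"
  have "\<bar>(hard_threshold t (\<theta> + x))\<^sup>2\<bar> \<le> 0 + 4 * x\<^sup>2" for x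
    using hard_threshold_square_le[OF assms, of x] by (auto split: if_splits simp: of_bool_def)
  note bd = std_normal_integrable_quadratic_bound[where f = "\<lambda>x. (hard_threshold t (\<theta> + x))\<^sup>2", OF _ this]
  show int: "integrable ?N (\<lambda>x. (hard_threshold t (\<theta> + x))\<^sup>2)"
    by (rule bd) measurable
  have "\<bar>\<integral>x. (hard_threshold t (\<theta> + x))\<^sup>2 \<partial>?N\<bar> \<le> 0 + 4"
    by (rule bd) measurable
  then show "(\<integral>x. (hard_threshold t (\<theta> + x))\<^sup>2 \<partial>?N) \<le> 4"
    by linarith
  have "integrable ?N (\<lambda>x. ?tail x)"
    by (rule std_normal_integrable_quadratic_bound[where a = 0 and b = 4]) (auto simp: abs_mult)
  then have "(\<integral>x. (hard_threshold t (\<theta> + x))\<^sup>2 \<partial>?N) \<le> (\<integral>x. ?tail x \<partial>?N)"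
    using int hard_threshold_square_le[OF assms] by (intro integral_mono)
  also have "\<dots> \<le> 4 * (4 * (1 + (t / 2)\<^sup>2) * exp (- (t / 2)\<^sup>2 / 2))"
    using std_normal_tail_second_moment[of "t / 2"] assms by simp
  finally show "(\<integral>x. (hard_threshold t (\<theta> + x))\<^sup>2 \<partial>?N) \<le> 16 * (1 + (t / 2)\<^sup>2) * exp (- (t / 2)\<^sup>2 / 2)"
    by (simp add: field_simps)
qed

text \<open>The ratio of the two densities is \<open>exp (- 2 * \<theta> * y)\<close>, which is at
  least \<open>1 - 2 * \<theta> * y\<close>. This bounds the difference from one side; replacing
  \<open>\<theta>\<close> by \<open>- \<theta>\<close> bounds it from the other, and the sum of
  densities covers both.\<close>

lemma std_normal_density_diff_le:
  "\<bar>std_normal_density (y - \<theta>) - std_normal_density (y + \<theta>)\<bar> \<le>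
    2 * \<bar>\<theta>\<bar> * \<bar>y\<bar> * (std_normal_density (y - \<theta>) + std_normal_density (y + \<theta>))"
proof -
  let ?\<phi> = std_normal_density
  have aux: "?\<phi> (y - \<theta>) - ?\<phi> (y + \<theta>) \<le> 2 * \<bar>\<theta>\<bar> * \<bar>y\<bar> * ?\<phi> (y - \<theta>)" for \<theta>
  proof -
    have "?\<phi> (y + \<theta>) = ?\<phi> (y - \<theta>) * exp (- 2 * \<theta> * y)"
      unfolding std_normal_density_def mult.assoc exp_add[symmetric]
      by (simp add: power2_eq_square field_simps)
    moreover have "?\<phi> (y - \<theta>) * (1 + (- 2 * \<theta> * y)) \<le> ?\<phi> (y - \<theta>) * exp (- 2 * \<theta> * y)"
      by (intro mult_left_mono exp_ge_add_one_self) simp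
    moreover have "?\<phi> (y - \<theta>) * (\<theta> * y) \<le> ?\<phi> (y - \<theta>) * (\<bar>\<theta>\<bar> * \<bar>y\<bar>)"
      by (intro mult_left_mono) (auto simp: abs_mult[symmetric])
    ultimately show ?thesis
      by (simp add: algebra_simps)
  qed
  have "0 \<le> 2 * \<bar>\<theta>\<bar> * \<bar>y\<bar> * ?\<phi> (y - \<theta>)" "0 \<le> 2 * \<bar>\<theta>\<bar> * \<bar>y\<bar> * ?\<phi> (y + \<theta>)"
    by simp_all
  then show ?thesis
    using aux[of \<theta>] aux[of "- \<theta>"] unfolding distrib_left diff_minus_eq_add abs_minus_cancel
      add_uminus_conv_diff by linarith
qed

text \<open>
  Since the threshold function is odd, its mean is half of the integral against the difference of
  the two densities centred at \<open>\<theta>\<close> and \<open>-\<theta>\<close>, which gains a factor \<open>\<bar>\<theta>\<bar>\<close>.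
\<close>

lemma hard_threshold_mean_le:
  assumes "\<bar>\<theta>\<bar> \<le> t / 2"
  shows "\<bar>\<integral>x. hard_threshold t (\<theta> + x) \<partial>std_normal_distribution\<bar> \<le> 8 * \<bar>\<theta>\<bar>"
proof -
  let ?\<phi> = std_normal_density and ?N = std_normal_distribution and ?h = "hard_threshold t"
  let ?E = "\<integral>x. ?h (\<theta> + x) \<partial>?N"
  interpret prob_space ?N
    by (rule prob_space_normal_density) simp
  have sq_meas: "(\<lambda>y. (?h y)\<^sup>2) \<in> borel_measurable borel"
    by measurable
  have sq: "integrable lborel (\<lambda>y. ?\<phi> (y - \<eta>) * (?h y)\<^sup>2)"
    "(\<integral>y. ?\<phi> (y - \<eta>) * (?h y)\<^sup>2 \<partial>lborel) \<le> 4"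
    "integrable lborel (\<lambda>y. ?\<phi> (y - \<eta>) * ?h y)" if "\<bar>\<eta>\<bar> \<le> t / 2" for \<eta>
  proof -
    note m = hard_threshold_second_moment(1,2)[OF that]
    show "integrable lborel (\<lambda>y. ?\<phi> (y - \<eta>) * (?h y)\<^sup>2)" "(\<integral>y. ?\<phi> (y - \<eta>) * (?h y)\<^sup>2 \<partial>lborel) \<le> 4"
      using m unfolding std_normal_integral_shift[of "\<lambda>y. (?h y)\<^sup>2", OF sq_meas] .
    have "integrable ?N (\<lambda>x. ?h (\<eta> + x))"
      by (rule square_integrable_imp_integrable[OF _ m(1)]) measurable
    then show "integrable lborel (\<lambda>y. ?\<phi> (y - \<eta>) * ?h y)"
      unfolding std_normal_integral_shift(2)[of ?h, OF hard_threshold_measurable] .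
  qed
  note sq1 = sq[OF assms] and sq2 = sq[of "- \<theta>"]
  have E1: "?E = (\<integral>y. ?\<phi> (y - \<theta>) * ?h y \<partial>lborel)"
    by (rule std_normal_integral_shift) simp
  have "?E = (\<integral>x. ?h (\<theta> + - x) \<partial>?N)"
    by (rule std_normal_integral_reflect[symmetric]) simp
  also have "\<dots> = (\<integral>x. - ?h (- \<theta> + x) \<partial>?N)"
    by (intro Bochner_Integration.integral_cong refl) (simp add: hard_threshold_minus[symmetric])
  also have "\<dots> = - (\<integral>y. ?\<phi> (y - - \<theta>) * ?h y \<partial>lborel)"
    using std_normal_integral_shift(1)[of ?h "- \<theta>"] by simp
  finally have "2 * ?E = (\<integral>y. ?\<phi> (y - \<theta>) * ?h y \<partial>lborel) - (\<integral>y. ?\<phi> (y + \<theta>) * ?h y \<partial>lborel)"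
    using E1 by simp
  also have "\<dots> = (\<integral>y. ?\<phi> (y - \<theta>) * ?h y - ?\<phi> (y + \<theta>) * ?h y \<partial>lborel)"
    using sq1 sq2 assms by simp
  finally have "2 * \<bar>?E\<bar> = \<bar>\<integral>y. ?\<phi> (y - \<theta>) * ?h y - ?\<phi> (y + \<theta>) * ?h y \<partial>lborel\<bar>"
    by simp
  also have "\<dots> \<le> (\<integral>y. \<bar>?\<phi> (y - \<theta>) * ?h y - ?\<phi> (y + \<theta>) * ?h y\<bar> \<partial>lborel)"
    by (rule integral_abs_bound)
  also have "\<dots> \<le> (\<integral>y. 2 * \<bar>\<theta>\<bar> * (?\<phi> (y - \<theta>) * (?h y)\<^sup>2 + ?\<phi> (y + \<theta>) * (?h y)\<^sup>2) \<partial>lborel)"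
  proof (intro integral_mono)
    fix y
    have "\<bar>?\<phi> (y - \<theta>) * ?h y - ?\<phi> (y + \<theta>) * ?h y\<bar> = \<bar>?\<phi> (y - \<theta>) - ?\<phi> (y + \<theta>)\<bar> * \<bar>?h y\<bar>"
      by (simp add: left_diff_distrib[symmetric] abs_mult)
    also have "\<dots> \<le> (2 * \<bar>\<theta>\<bar> * \<bar>y\<bar> * (?\<phi> (y - \<theta>) + ?\<phi> (y + \<theta>))) * \<bar>?h y\<bar>"
      by (intro mult_right_mono std_normal_density_diff_le) simp
    also have "\<dots> = 2 * \<bar>\<theta>\<bar> * (?\<phi> (y - \<theta>) + ?\<phi> (y + \<theta>)) * (\<bar>y\<bar> * \<bar>?h y\<bar>)"
      by simp
    \<comment> \<open>The function takes only the values 0 and \<open>y\<close>, so the factor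
      \<open>\<bar>y\<bar>\<close> from the density comparison merges into its square. The second
      moment bound 4 then applies at each of the centres \<open>\<theta>\<close> and
      \<open>- \<theta>\<close>.\<close>
    also have "\<bar>y\<bar> * \<bar>?h y\<bar> = (?h y)\<^sup>2"
      by (simp add: hard_threshold_def power2_eq_square)
    finally show "\<bar>?\<phi> (y - \<theta>) * ?h y - ?\<phi> (y + \<theta>) * ?h y\<bar> \<le>
        2 * \<bar>\<theta>\<bar> * (?\<phi> (y - \<theta>) * (?h y)\<^sup>2 + ?\<phi> (y + \<theta>) * (?h y)\<^sup>2)"
      by (simp add: algebra_simps)
  qed (use sq1 sq2 assms in auto)
  also have "\<dots> = 2 * \<bar>\<theta>\<bar> *
      ((\<integral>y. ?\<phi> (y - \<theta>) * (?h y)\<^sup>2 \<partial>lborel) + (\<integral>y. ?\<phi> (y + \<theta>) * (?h y)\<^sup>2 \<partial>lborel))"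
    using sq1 sq2 assms by simp
  also have "\<dots> \<le> 2 * \<bar>\<theta>\<bar> * (4 + 4)"
    using sq1(2) sq2(2) assms by (intro mult_left_mono add_mono) simp_all
  finally show ?thesis
    by simp
qed

text \<open>Thresholding moves its argument by at most \<open>t\<close>, whatever
  \<open>\<theta>\<close> is. The error is therefore the noise plus a term bounded by
  \<open>t\<close>; the noise has mean 0, which leaves only the bounded term in the bias.\<close>

lemma hard_threshold_error:
  assumes "0 \<le> t"
  shows "integrable std_normal_distribution (\<lambda>x. (hard_threshold t (\<theta> + x) - \<theta>)\<^sup>2)"
    and "(\<integral>x. (hard_threshold t (\<theta> + x) - \<theta>)\<^sup>2 \<partial>std_normal_distribution) \<le> 2 * t\<^sup>2 + 2"
    and "\<bar>\<integral>x. hard_threshold t (\<theta> + x) - \<theta> \<partial>std_normal_distribution\<bar> \<le> t"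
proof -
  let ?N = std_normal_distribution
  define e where "e = (\<lambda>x. hard_threshold t (\<theta> + x) - \<theta> - x)"
  have e_meas [measurable]: "e \<in> borel_measurable borel"
    unfolding e_def by measurable
  have e_le: "\<bar>e x\<bar> \<le> t" for x
    using assms by (cases "t < \<bar>\<theta> + x\<bar>") (auto simp: e_def hard_threshold_def)
  have "\<bar>(hard_threshold t (\<theta> + x) - \<theta>)\<^sup>2\<bar> \<le> 2 * t\<^sup>2 + 2 * x\<^sup>2" for x
  proof -
    have "hard_threshold t (\<theta> + x) - \<theta> = x + e x"
      by (simp add: e_def)
    moreover have "(e x)\<^sup>2 \<le> t\<^sup>2"
      using e_le[of x] assms by (simp add: abs_le_square_iff[symmetric])
    ultimately show ?thesis
      using sum_squares_bound[of x "e x"] unfolding abs_power2 by (simp only: power2_sum)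
  qed
  note sq = std_normal_integrable_quadratic_bound
    [where f = "\<lambda>x. (hard_threshold t (\<theta> + x) - \<theta>)\<^sup>2", OF _ this]
  show "integrable ?N (\<lambda>x. (hard_threshold t (\<theta> + x) - \<theta>)\<^sup>2)"
    by (rule sq) measurable
  have "\<bar>\<integral>x. (hard_threshold t (\<theta> + x) - \<theta>)\<^sup>2 \<partial>?N\<bar> \<le> 2 * t\<^sup>2 + 2"
    by (rule sq) measurable
  then show "(\<integral>x. (hard_threshold t (\<theta> + x) - \<theta>)\<^sup>2 \<partial>?N) \<le> 2 * t\<^sup>2 + 2"
    by linarith
  have "\<bar>e x\<bar> \<le> t + 0 * x\<^sup>2" for x
    using e_le by simp
  note e_int = std_normal_integrable_quadratic_bound[OF e_meas this]
  have "integrable ?N (\<lambda>x. x)" "(\<integral>x. x \<partial>?N) = 0"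
    using integrable_std_normal_distribution_moment[of 1] integral_std_normal_distribution_moment_odd[of 1]
    by simp_all
  then have "(\<integral>x. x + e x \<partial>?N) = (\<integral>x. e x \<partial>?N)"
    using e_int(1) by simp
  then show "\<bar>\<integral>x. hard_threshold t (\<theta> + x) - \<theta> \<partial>?N\<bar> \<le> t"
    using e_int(2) by (simp add: e_def)
qed

text \<open>Subtracting the constant \<open>\<theta>\<close> does not change the variance, so the
  tail bound on the second moment applies. In the bias it adds one
  \<open>\<bar>\<theta>\<bar>\<close> to the 8 from the mean.\<close>

lemma hard_threshold_error_small:
  assumes "\<bar>\<theta>\<bar> \<le> t / 2"
  shows "(\<integral>x. (hard_threshold t (\<theta> + x) - \<theta>)\<^sup>2 \<partial>std_normal_distribution) -
      (\<integral>x. hard_threshold t (\<theta> + x) - \<theta> \<partial>std_normal_distribution)\<^sup>2 \<le>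
      16 * (1 + (t / 2)\<^sup>2) * exp (- (t / 2)\<^sup>2 / 2)"
    and "\<bar>\<integral>x. hard_threshold t (\<theta> + x) - \<theta> \<partial>std_normal_distribution\<bar> \<le> 9 * \<bar>\<theta>\<bar>"
proof -
  let ?N = std_normal_distribution
  interpret prob_space ?N
    by (rule prob_space_normal_density) simp
  let ?h = "\<lambda>x. hard_threshold t (\<theta> + x)"
  have sq: "integrable ?N (\<lambda>x. (?h x)\<^sup>2)"
    by (rule hard_threshold_second_moment) fact
  have h: "integrable ?N ?h"
    by (rule square_integrable_imp_integrable[OF _ sq]) measurable
  have mean: "(\<integral>x. ?h x - \<theta> \<partial>?N) = (\<integral>x. ?h x \<partial>?N) - \<theta>"
    using h by (simp add: prob_space[simplified])
  have "(\<integral>x. (?h x - \<theta>)\<^sup>2 \<partial>?N) = (\<integral>x. (?h x)\<^sup>2 - 2 * \<theta> * ?h x + \<theta>\<^sup>2 \<partial>?N)"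
    by (intro Bochner_Integration.integral_cong) (auto simp: power2_diff)
  also have "\<dots> = (\<integral>x. (?h x)\<^sup>2 \<partial>?N) - 2 * \<theta> * (\<integral>x. ?h x \<partial>?N) + \<theta>\<^sup>2"
    using h sq by (simp add: prob_space[simplified])
  finally have "(\<integral>x. (?h x - \<theta>)\<^sup>2 \<partial>?N) - (\<integral>x. ?h x - \<theta> \<partial>?N)\<^sup>2 =
      (\<integral>x. (?h x)\<^sup>2 \<partial>?N) - (\<integral>x. ?h x \<partial>?N)\<^sup>2"
    by (simp add: mean power2_diff)
  also have "\<dots> \<le> (\<integral>x. (?h x)\<^sup>2 \<partial>?N)"
    by simp
  also have "\<dots> \<le> 16 * (1 + (t / 2)\<^sup>2) * exp (- (t / 2)\<^sup>2 / 2)"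
    by (rule hard_threshold_second_moment) fact
  finally show "(\<integral>x. (?h x - \<theta>)\<^sup>2 \<partial>?N) - (\<integral>x. ?h x - \<theta> \<partial>?N)\<^sup>2 \<le>
      16 * (1 + (t / 2)\<^sup>2) * exp (- (t / 2)\<^sup>2 / 2)" .
  show "\<bar>\<integral>x. ?h x - \<theta> \<partial>?N\<bar> \<le> 9 * \<bar>\<theta>\<bar>"
    using hard_threshold_mean_le[OF assms] unfolding mean by linarith
qed

text \<open>Large coordinates are controlled by their number, small ones in two ways: each has an
  exponentially small variance, so that even \<open>card I\<close> of them are affordable, and their
  biases add up to a multiple of their \<open>l_1\<close> norm.\<close>

lemma hard_threshold_sum_error:
  fixes \<theta> :: "'i \<Rightarrow> real"
  defines "W \<equiv> \<lambda>t i x. hard_threshold t (\<theta> i + x) - \<theta> i"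
  assumes "finite I" "0 \<le> t"
    and large: "real (card {i \<in> I. t / 2 < \<bar>\<theta> i\<bar>}) \<le> k"
    and small: "(\<Sum>i\<in>{i \<in> I. \<bar>\<theta> i\<bar> \<le> t / 2}. \<bar>\<theta> i\<bar>) \<le> b"
  shows "(\<Sum>i\<in>I. (\<integral>x. (W t i x)\<^sup>2 \<partial>std_normal_distribution) - (\<integral>x. W t i x \<partial>std_normal_distribution)\<^sup>2) +
      (\<Sum>i\<in>I. \<integral>x. W t i x \<partial>std_normal_distribution)\<^sup>2 \<le>
    k * (2 * t\<^sup>2 + 2) + real (card I) * (16 * (1 + (t / 2)\<^sup>2) * exp (- (t / 2)\<^sup>2 / 2)) +
      (k * t + 9 * b)\<^sup>2"
proof -
  let ?N = std_normal_distribution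
  let ?L = "{i \<in> I. t / 2 < \<bar>\<theta> i\<bar>}" and ?S = "{i \<in> I. \<bar>\<theta> i\<bar> \<le> t / 2}"
  let ?c = "16 * (1 + (t / 2)\<^sup>2) * exp (- (t / 2)\<^sup>2 / 2)"
  let ?b = "\<lambda>i. \<integral>x. W t i x \<partial>?N"
  let ?v = "\<lambda>i. (\<integral>x. (W t i x)\<^sup>2 \<partial>?N) - (?b i)\<^sup>2"
  have split: "sum f I = sum f ?L + sum f ?S" for f :: "'i \<Rightarrow> real"
    using \<open>finite I\<close> by (subst sum.union_disjoint[symmetric]) (auto intro!: sum.cong)
  have "sum ?v ?L \<le> (\<Sum>i\<in>?L. 2 * t\<^sup>2 + 2)"
  proof (rule sum_mono)
    fix i
    have "(\<integral>x. (W t i x)\<^sup>2 \<partial>?N) \<le> 2 * t\<^sup>2 + 2"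
      using hard_threshold_error(2)[OF \<open>0 \<le> t\<close>] unfolding W_def .
    then show "?v i \<le> 2 * t\<^sup>2 + 2"
      using zero_le_power2[of "?b i"] by linarith
  qed
  also have "\<dots> \<le> k * (2 * t\<^sup>2 + 2)"
    using mult_right_mono[OF large, of "2 * t\<^sup>2 + 2"] by simp
  finally have "sum ?v ?L \<le> k * (2 * t\<^sup>2 + 2)" .
  moreover have "sum ?v ?S \<le> (\<Sum>i\<in>?S. ?c)"
    unfolding W_def by (intro sum_mono hard_threshold_error_small) simp
  then have "sum ?v ?S \<le> real (card I) * ?c"
    using card_mono[OF \<open>finite I\<close>, of ?S]
    by (elim order_trans) (auto intro!: mult_right_mono)
  moreover have "\<bar>sum ?b I\<bar> \<le> k * t + 9 * b"
  proof -
    have "\<bar>sum ?b I\<bar> \<le> (\<Sum>i\<in>I. \<bar>?b i\<bar>)"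
      by (rule sum_abs)
    also have "\<dots> = (\<Sum>i\<in>?L. \<bar>?b i\<bar>) + (\<Sum>i\<in>?S. \<bar>?b i\<bar>)"
      by (rule split)
    also have "(\<Sum>i\<in>?L. \<bar>?b i\<bar>) \<le> (\<Sum>i\<in>?L. t)"
      unfolding W_def by (intro sum_mono hard_threshold_error \<open>0 \<le> t\<close>)
    also have "\<dots> \<le> k * t"
      using mult_right_mono[OF large \<open>0 \<le> t\<close>] by simp
    also have "(\<Sum>i\<in>?S. \<bar>?b i\<bar>) \<le> (\<Sum>i\<in>?S. 9 * \<bar>\<theta> i\<bar>)"
      unfolding W_def by (intro sum_mono hard_threshold_error_small) simp
    also have "\<dots> \<le> 9 * b"
      using small by (simp add: sum_distrib_left[symmetric])
    finally show ?thesis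
      by simp
  qed
  then have "(sum ?b I)\<^sup>2 \<le> (k * t + 9 * b)\<^sup>2"
    by (simp add: abs_le_square_iff[symmetric])
  ultimately show ?thesis
    unfolding split[of ?v] by linarith
qed

section \<open>Sparsity in \<open>l_q\<close> balls and the index \<open>m\<close>\<close>

text \<open>Each entry factors into powers with exponents \<open>1 - q\<close> and \<open>q\<close>;
  since \<open>1 - q\<close> is nonnegative, the first factor is largest at
  \<open>s\<close>.\<close>

lemma sum_abs_le_powr_sum:
  fixes x :: "'i \<Rightarrow> real"
  assumes "q \<le> 1" "s > 0" "\<And>i. i \<in> I \<Longrightarrow> \<bar>x i\<bar> \<le> s"
  shows "(\<Sum>i\<in>I. \<bar>x i\<bar>) \<le> s powr (1 - q) * (\<Sum>i\<in>I. \<bar>x i\<bar> powr q)"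
  unfolding sum_distrib_left
proof (rule sum_mono)
  fix i assume "i \<in> I"
  show "\<bar>x i\<bar> \<le> s powr (1 - q) * \<bar>x i\<bar> powr q"
  proof (cases "x i = 0")
    case False
    then have "\<bar>x i\<bar> = \<bar>x i\<bar> powr (1 - q) * \<bar>x i\<bar> powr q"
      by (simp add: powr_add[symmetric])
    also have "\<dots> \<le> s powr (1 - q) * \<bar>x i\<bar> powr q"
      using assms \<open>i \<in> I\<close> by (intro mult_right_mono powr_mono2) auto
    finally show ?thesis .
  qed simp
qed

text \<open>Markov's inequality for counting measure.\<close>

lemma card_mult_powr_le_powr_sum:
  fixes x :: "'i \<Rightarrow> real"
  assumes "0 \<le> q" "0 \<le> s" "\<And>i. i \<in> I \<Longrightarrow> s \<le> \<bar>x i\<bar>"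
  shows "real (card I) * s powr q \<le> (\<Sum>i\<in>I. \<bar>x i\<bar> powr q)"
proof -
  have "(\<Sum>i\<in>I. s powr q) \<le> (\<Sum>i\<in>I. \<bar>x i\<bar> powr q)"
    using assms by (intro sum_mono powr_mono2) auto
  then show ?thesis
    by simp
qed

lemma lq_ball_powr_sum_le:
  assumes "\<theta> \<in> lq_ball d q r" "0 < q"
  shows "(\<Sum>i=1..d. \<bar>\<theta> i\<bar> powr q) \<le> r powr q"
proof -
  let ?s = "\<Sum>i=1..d. \<bar>\<theta> i\<bar> powr q"
  have "0 \<le> ?s"
    by (intro sum_nonneg) simp
  then have "?s = (?s powr (1 / q)) powr q"
    using \<open>0 < q\<close> by (simp add: powr_powr)
  also have "\<dots> \<le> r powr q"
    using assms by (intro powr_mono2) (auto simp: lq_ball_def lq_norm_def)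
  finally show ?thesis .
qed

lemma lq_ball_sum_abs_le:
  assumes "\<theta> \<in> lq_ball d q r" "0 < q" "q \<le> 1" "0 < r"
  shows "(\<Sum>i=1..d. \<bar>\<theta> i\<bar>) \<le> r"
proof -
  note sum = lq_ball_powr_sum_le[OF assms(1,2)]
  have "\<bar>\<theta> i\<bar> \<le> r" if "i \<in> {1..d}" for i
  proof (rule ccontr)
    assume "\<not> \<bar>\<theta> i\<bar> \<le> r"
    then have "r powr q < \<bar>\<theta> i\<bar> powr q"
      using assms by (intro powr_less_mono2) auto
    also have "\<dots> \<le> (\<Sum>i=1..d. \<bar>\<theta> i\<bar> powr q)"
      using that by (intro member_le_sum) auto
    finally show False
      using sum by simp
  qed
  then have "(\<Sum>i=1..d. \<bar>\<theta> i\<bar>) \<le> r powr (1 - q) * (\<Sum>i=1..d. \<bar>\<theta> i\<bar> powr q)"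
    using assms by (intro sum_abs_le_powr_sum) auto
  also have "\<dots> \<le> r powr (1 - q) * r powr q"
    using sum by (intro mult_left_mono) auto
  finally show ?thesis
    using \<open>0 < r\<close> by (simp add: powr_add[symmetric])
qed

lemma m_index_le: "m_index d r \<sigma> q \<le> d"
proof (cases "m_set d r \<sigma> q = {}")
  case False
  have "finite (m_set d r \<sigma> q)"
    by (simp add: m_set_def)
  then have "Max (m_set d r \<sigma> q) \<in> m_set d r \<sigma> q"
    using False by (rule Max_in)
  then show ?thesis
    using False by (simp add: m_index_def m_set_def)
qed (simp add: m_index_def)

text \<open>This includes both extremes: an empty set has index 0, and for index \<open>d\<close>
  the successor leaves the range \<open>{1..d}\<close>. Only below \<open>d\<close> does it mean
  that the defining inequality fails.\<close>

lemma Suc_m_index_notin: "Suc (m_index d r \<sigma> q) \<notin> m_set d r \<sigma> q"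
proof
  assume *: "Suc (m_index d r \<sigma> q) \<in> m_set d r \<sigma> q"
  have "finite (m_set d r \<sigma> q)"
    by (simp add: m_set_def)
  then have "Suc (m_index d r \<sigma> q) \<le> Max (m_set d r \<sigma> q)"
    using * by (rule Max_ge)
  then show False
    using * by (auto simp: m_index_def split: if_splits)
qed

text \<open>The defining inequality fails at \<open>m + 1\<close>. The logarithm decreases in its
  index, so it may be taken at \<open>m\<close> instead; a square root and a \<open>q\<close>-th
  power then isolate the radius.\<close>

lemma radius_powr_le_m_index:
  assumes "0 < q" "0 < r" "0 < \<sigma>" "m = m_index d r \<sigma> q" "1 \<le> m" "m < d"
  shows "r powr q \<le> (\<sigma> * sqrt (ln (1 + real d / (real m)\<^sup>2))) powr q * (real m + 1)"
proof -
  let ?l = "ln (1 + real d / (real m)\<^sup>2)" and ?n = "real m + 1"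
  have "r\<^sup>2 * ?n powr (- 2 / q) < \<sigma>\<^sup>2 * ln (1 + real d / ?n\<^sup>2)"
    using Suc_m_index_notin[of d r \<sigma> q] assms by (auto simp: m_set_def add.commute)
  also have "\<dots> \<le> \<sigma>\<^sup>2 * ?l"
  proof -
    have "real d / ?n\<^sup>2 \<le> real d / (real m)\<^sup>2"
      using assms by (intro divide_left_mono power_mono) auto
    then show ?thesis
      by (intro mult_left_mono ln_mono add_left_mono) (simp_all add: add_pos_nonneg)
  qed
  also have "r\<^sup>2 * ?n powr (- 2 / q) = (r * ?n powr (- 1 / q))\<^sup>2"
    by (simp add: power_mult_distrib power2_eq_square powr_add[symmetric])
  also have "\<sigma>\<^sup>2 * ?l = (\<sigma> * sqrt ?l)\<^sup>2"
    by (simp add: power_mult_distrib)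
  finally have "(r * ?n powr (- 1 / q))\<^sup>2 < (\<sigma> * sqrt ?l)\<^sup>2" .
  moreover have "0 \<le> \<sigma> * sqrt ?l"
    using \<open>0 < \<sigma>\<close> by simp
  ultimately have "r * ?n powr (- 1 / q) \<le> \<sigma> * sqrt ?l"
    by (rule power2_le_imp_le[OF less_imp_le])
  then have "(r * ?n powr (- 1 / q)) powr q \<le> (\<sigma> * sqrt ?l) powr q"
    using assms by (intro powr_mono2) auto
  moreover have "(r * ?n powr (- 1 / q)) powr q = r powr q / ?n"
    using assms by (simp add: powr_mult powr_powr powr_divide powr_minus_divide)
  ultimately show ?thesis
    by (simp add: divide_le_eq)
qed

text \<open>Maximality of \<open>m\<close> bounds the \<open>q\<close>-th power sum of
  \<open>\<theta>\<close> by \<open>m + 1\<close> times \<open>s powr q\<close>. Markov's inequality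
  turns this into the count of large entries, and interpolation between \<open>l_q\<close> and the
  sup bound \<open>s\<close> into the \<open>l_1\<close> bound.\<close>

lemma m_index_sparsity:
  assumes "0 < q" "q \<le> 1" "0 < r" "0 < \<sigma>" "m = m_index d r \<sigma> q" "1 \<le> m" "\<theta> \<in> lq_ball d q r"
  defines "s \<equiv> \<sigma> * sqrt (2 * ln (1 + real d / (real m)\<^sup>2))"
  shows "real (card {i \<in> {1..d}. s < \<bar>\<theta> i\<bar>}) \<le> real m + 1"
    and "(\<Sum>i\<in>{i \<in> {1..d}. \<bar>\<theta> i\<bar> \<le> s}. \<bar>\<theta> i\<bar>) \<le> (real m + 1) * s"
proof -
  let ?L = "{i \<in> {1..d}. s < \<bar>\<theta> i\<bar>}" and ?S = "{i \<in> {1..d}. \<bar>\<theta> i\<bar> \<le> s}"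
  have "m \<le> d"
    unfolding assms by (rule m_index_le)
  then have ln_pos: "0 < ln (1 + real d / (real m)\<^sup>2)"
    using \<open>1 \<le> m\<close> by (intro ln_gt_zero) auto
  then have "0 < s"
    using \<open>0 < \<sigma>\<close> by (simp add: s_def)
  have card_le: "card A \<le> d" if "A \<subseteq> {1..d}" for A
    using card_mono[OF _ that] by simp
  have "real (card ?L) \<le> real m + 1 \<and> (\<Sum>i\<in>?S. \<bar>\<theta> i\<bar>) \<le> (real m + 1) * s"
  proof (cases "m = d")
    \<comment> \<open>Maximality gives no inequality here, but there are only \<open>d = m\<close>
      coordinates, so counting them proves both bounds.\<close>
    case True
    have card: "card ?L \<le> d" "card ?S \<le> d"
      by (intro card_le; blast)+
    have "(\<Sum>i\<in>?S. \<bar>\<theta> i\<bar>) \<le> real (card ?S) * s"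
      by (rule sum_bounded_above) simp
    also have "\<dots> \<le> (real m + 1) * s"
      using card(2) True \<open>0 < s\<close> by (intro mult_right_mono) simp_all
    finally show ?thesis
      using card(1) True by simp
  next
    case False
    have "r powr q \<le> (\<sigma> * sqrt (ln (1 + real d / (real m)\<^sup>2))) powr q * (real m + 1)"
      using assms False \<open>m \<le> d\<close> by (intro radius_powr_le_m_index) auto
    also have "\<dots> \<le> s powr q * (real m + 1)"
      unfolding s_def using assms ln_pos by (intro mult_right_mono powr_mono2 mult_left_mono) auto
    finally have r: "r powr q \<le> s powr q * (real m + 1)" .
    have sub: "(\<Sum>i\<in>A. \<bar>\<theta> i\<bar> powr q) \<le> s powr q * (real m + 1)" if "A \<subseteq> {1..d}" for A
      using lq_ball_powr_sum_le[OF \<open>\<theta> \<in> lq_ball d q r\<close> \<open>0 < q\<close>] r that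
        sum_mono2[of "{1..d}" A "\<lambda>i. \<bar>\<theta> i\<bar> powr q"] by fastforce
    have "real (card ?L) * s powr q \<le> (\<Sum>i\<in>?L. \<bar>\<theta> i\<bar> powr q)"
      using \<open>0 < q\<close> \<open>0 < s\<close> by (intro card_mult_powr_le_powr_sum) auto
    also have "\<dots> \<le> s powr q * (real m + 1)"
      by (rule sub) auto
    finally have "real (card ?L) \<le> real m + 1"
      using \<open>0 < s\<close> by (simp add: mult.commute)
    moreover have "(\<Sum>i\<in>?S. \<bar>\<theta> i\<bar>) \<le> s powr (1 - q) * (\<Sum>i\<in>?S. \<bar>\<theta> i\<bar> powr q)"
      using \<open>q \<le> 1\<close> \<open>0 < s\<close> by (intro sum_abs_le_powr_sum) auto
    moreover have "\<dots> \<le> s powr (1 - q) * (s powr q * (real m + 1))"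
      by (intro mult_left_mono sub) auto
    moreover have "s powr (1 - q) * s powr q = s"
      using \<open>0 < s\<close> by (simp add: powr_add[symmetric])
    ultimately show ?thesis
      unfolding mult.assoc[symmetric] by (simp add: mult.commute[of "real m + 1"])
  qed
  then show "real (card ?L) \<le> real m + 1" "(\<Sum>i\<in>?S. \<bar>\<theta> i\<bar>) \<le> (real m + 1) * s"
    by auto
qed

section \<open>Risk of the estimator in its three regimes\<close>

text \<open>All three regimes sum one function over the coordinates: zero, the identity, or a
  threshold. Pulled back to the noise, the error is a sum over independent coordinates, and its
  second moment splits into variances and squared total bias.\<close>

lemma risk_coordinatewise:
  assumes est: "\<And>y. estimator d r \<sigma> q y = (\<Sum>j=1..d. f (y j))"
    and [measurable]: "f \<in> borel_measurable borel"
    and int: "\<And>j. j \<in> {1..d} \<Longrightarrow> integrable std_normal_distribution (\<lambda>x. (f (\<theta> j + \<sigma> * x) - \<theta> j)\<^sup>2)"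
  shows "risk d r \<sigma> q \<theta> = ennreal
    ((\<Sum>j=1..d. (\<integral>x. (f (\<theta> j + \<sigma> * x) - \<theta> j)\<^sup>2 \<partial>std_normal_distribution) -
        (\<integral>x. f (\<theta> j + \<sigma> * x) - \<theta> j \<partial>std_normal_distribution)\<^sup>2) +
      (\<Sum>j=1..d. \<integral>x. f (\<theta> j + \<sigma> * x) - \<theta> j \<partial>std_normal_distribution)\<^sup>2)"
proof -
  let ?N = std_normal_distribution
  let ?P = "\<Pi>\<^sub>M j\<in>{1..d}. ?N" and ?Q = "\<Pi>\<^sub>M j\<in>{1..d}. (borel :: real measure)"
  let ?T = "\<lambda>\<xi>. \<lambda>j\<in>{1..d}. \<theta> j + \<sigma> * \<xi> j"
  have [measurable_cong]: "sets ?P = sets ?Q"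
    by (intro sets_PiM_cong) auto
  have [measurable]: "?T \<in> measurable ?P ?Q"
    by measurable
  have "risk d r \<sigma> q \<theta> = (\<integral>\<^sup>+ y. ennreal (((\<Sum>j=1..d. f (y j)) - lin_functional d \<theta>)\<^sup>2) \<partial>distr ?P ?Q ?T)"
    by (simp add: risk_def est obs_law_def noise_measure_def)
  also have "\<dots> = (\<integral>\<^sup>+ \<xi>. ennreal (((\<Sum>j=1..d. f (?T \<xi> j)) - lin_functional d \<theta>)\<^sup>2) \<partial>?P)"
    by (rule nn_integral_distr) measurable
  also have "\<dots> = (\<integral>\<^sup>+ \<xi>. ennreal ((\<Sum>j=1..d. f (\<theta> j + \<sigma> * \<xi> j) - \<theta> j)\<^sup>2) \<partial>?P)"
    by (simp add: lin_functional_def sum_subtractf)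
  also have "\<dots> = ennreal
    ((\<Sum>j=1..d. (\<integral>x. (f (\<theta> j + \<sigma> * x) - \<theta> j)\<^sup>2 \<partial>?N) - (\<integral>x. f (\<theta> j + \<sigma> * x) - \<theta> j \<partial>?N)\<^sup>2) +
      (\<Sum>j=1..d. \<integral>x. f (\<theta> j + \<sigma> * x) - \<theta> j \<partial>?N)\<^sup>2)"
    by (rule nn_integral_PiM_sum_square[where g = "\<lambda>j x. f (\<theta> j + \<sigma> * x) - \<theta> j"])
      (use int in \<open>auto intro: prob_space_normal_density\<close>)
  finally show ?thesis .
qed

lemma risk_zero_estimator:
  assumes "0 < q" "q \<le> 1" "0 < r" "m_index d r \<sigma> q = 0" "\<theta> \<in> lq_ball d q r"
  shows "risk d r \<sigma> q \<theta> \<le> ennreal (r\<^sup>2)"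
proof -
  interpret prob_space std_normal_distribution
    by (rule prob_space_normal_density) simp
  have "risk d r \<sigma> q \<theta> = ennreal ((\<Sum>j=1..d. \<theta> j)\<^sup>2)"
    by (subst risk_coordinatewise[where f = "\<lambda>_. 0"])
      (auto simp: estimator_def assms prob_space[simplified] sum_negf)
  moreover have "\<bar>\<Sum>j=1..d. \<theta> j\<bar> \<le> r"
    using sum_abs[of \<theta> "{1..d}"] lq_ball_sum_abs_le[OF assms(5,1-3)] by linarith
  then have "(\<Sum>j=1..d. \<theta> j)\<^sup>2 \<le> r\<^sup>2"
    using \<open>0 < r\<close> by (simp add: abs_le_square_iff[symmetric])
  ultimately show ?thesis
    by (simp add: ennreal_leI)
qed

lemma risk_sum_estimator:
  assumes "sqrt (real d) < real (m_index d r \<sigma> q)"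
  shows "risk d r \<sigma> q \<theta> = ennreal (\<sigma>\<^sup>2 * real d)"
proof -
  have "(\<integral>x. x \<partial>std_normal_distribution) = 0"
    using integral_std_normal_distribution_moment_odd[of 1] by simp
  then show ?thesis
    using std_normal_has_moment_2 assms
    by (subst risk_coordinatewise[where f = "\<lambda>y. y"])
      (auto simp: estimator_def has_bochner_integral_iff power_mult_distrib mult.commute)
qed

lemma risk_threshold_estimator:
  assumes "0 < q" "q \<le> 1" "0 < r" "0 < \<sigma>" "m = m_index d r \<sigma> q" "1 \<le> m" "real m \<le> sqrt (real d)"
    and "\<theta> \<in> lq_ball d q r"
  shows "risk d r \<sigma> q \<theta> \<le> ennreal (1072 * (\<sigma>\<^sup>2 * (real m)\<^sup>2 * ln (1 + real d / (real m)\<^sup>2)))"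
proof -
  let ?N = std_normal_distribution
  define L where "L = ln (1 + real d / (real m)\<^sup>2)"
  define s where "s = sqrt (2 * L)"
  define W where "W = (\<lambda>j x. hard_threshold (2 * s) (\<theta> j / \<sigma> + x) - \<theta> j / \<sigma>)"
  let ?V = "\<Sum>j=1..d. (\<integral>x. (W j x)\<^sup>2 \<partial>?N) - (\<integral>x. W j x \<partial>?N)\<^sup>2"
  let ?B = "(\<Sum>j=1..d. \<integral>x. W j x \<partial>?N)\<^sup>2"
  have "(real m)\<^sup>2 \<le> (sqrt (real d))\<^sup>2"
    using assms by (intro power_mono) auto
  then have "(real m)\<^sup>2 \<le> real d"
    by simp
  then have ratio: "1 \<le> real d / (real m)\<^sup>2"
    using assms by simp
  have "ln 2 \<le> L"
    unfolding L_def using ratio by (intro ln_mono) auto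
  \<comment> \<open>The logarithm is bounded below because \<open>m\<^sup>2\<close> is at most
    \<open>d\<close>; this lets additive constants be absorbed into multiples of
    \<open>L\<close>.\<close>
  then have lam: "1 / 2 \<le> L"
    using ln_2_less_1 ln2_ge_two_thirds by linarith
  then have "0 \<le> s" and s2: "s\<^sup>2 = 2 * L"
    by (simp_all add: s_def)
  have scale: "hard_threshold (2 * \<sigma> * s) (\<theta> j + \<sigma> * x) - \<theta> j = \<sigma> * W j x" for j x
    using hard_threshold_scale[OF \<open>0 < \<sigma>\<close>, of "2 * s" "\<theta> j / \<sigma> + x"] \<open>0 < \<sigma>\<close>
    by (simp add: W_def distrib_left right_diff_distrib mult.left_commute mult.commute)
  have "risk d r \<sigma> q \<theta> = ennreal
      ((\<Sum>j=1..d. (\<integral>x. (\<sigma> * W j x)\<^sup>2 \<partial>?N) - (\<integral>x. \<sigma> * W j x \<partial>?N)\<^sup>2) + (\<Sum>j=1..d. \<integral>x. \<sigma> * W j x \<partial>?N)\<^sup>2)"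
  proof (subst risk_coordinatewise[where f = "hard_threshold (2 * \<sigma> * s)"])
    show "estimator d r \<sigma> q y = (\<Sum>j=1..d. hard_threshold (2 * \<sigma> * s) (y j))" for y
      using assms by (simp add: estimator_def Let_def hard_threshold_def s_def L_def)
    show "integrable ?N (\<lambda>x. (hard_threshold (2 * \<sigma> * s) (\<theta> j + \<sigma> * x) - \<theta> j)\<^sup>2)" for j
      unfolding scale power_mult_distrib W_def
      using \<open>0 \<le> s\<close> by (intro integrable_mult_right hard_threshold_error) simp
  qed (simp_all only: scale hard_threshold_measurable)
  also have "\<dots> = ennreal (\<sigma>\<^sup>2 * (?V + ?B))"
    by (simp add: power_mult_distrib sum_distrib_left[symmetric] right_diff_distrib[symmetric]
        distrib_left[symmetric])
  finally have risk: "risk d r \<sigma> q \<theta> = ennreal (\<sigma>\<^sup>2 * (?V + ?B))" .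

  have scaled: "\<bar>\<theta> j / \<sigma>\<bar> \<le> 2 * s / 2 \<longleftrightarrow> \<bar>\<theta> j\<bar> \<le> \<sigma> * s" for j
    using \<open>0 < \<sigma>\<close> by (simp add: abs_div divide_le_eq mult.commute)
  note sparse = m_index_sparsity[OF assms(1-6,8), folded L_def, folded s_def]
  have large: "real (card {j \<in> {1..d}. 2 * s / 2 < \<bar>\<theta> j / \<sigma>\<bar>}) \<le> real m + 1"
    using sparse(1) unfolding not_le[symmetric] scaled .
  have "(\<Sum>j\<in>{j \<in> {1..d}. \<bar>\<theta> j / \<sigma>\<bar> \<le> 2 * s / 2}. \<bar>\<theta> j / \<sigma>\<bar>) =
      (\<Sum>j\<in>{j \<in> {1..d}. \<bar>\<theta> j\<bar> \<le> \<sigma> * s}. \<bar>\<theta> j\<bar>) / \<sigma>"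
    unfolding scaled using \<open>0 < \<sigma>\<close> by (simp add: abs_div sum_divide_distrib)
  also have "\<dots> \<le> (real m + 1) * s"
    using sparse(2) \<open>0 < \<sigma>\<close> by (simp add: divide_le_eq mult_ac)
  finally have "?V + ?B \<le> (real m + 1) * (2 * (2 * s)\<^sup>2 + 2) +
      real (card {1..d}) * (16 * (1 + (2 * s / 2)\<^sup>2) * exp (- (2 * s / 2)\<^sup>2 / 2)) +
      ((real m + 1) * (2 * s) + 9 * ((real m + 1) * s))\<^sup>2"
    unfolding W_def using large \<open>0 \<le> s\<close> by (intro hard_threshold_sum_error) auto
  \<comment> \<open>With threshold \<open>2 * s\<close> and \<open>s\<^sup>2 = 2 * L\<close> the
    Gaussian exponent is exactly \<open>- L\<close>. The bias has coefficient
    \<open>2 + 9 = 11\<close>, and \<open>242 = 2 * 11\<^sup>2\<close>.\<close>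
  also have "\<dots> = (real m + 1) * (2 + 16 * L) + (16 + 32 * L) * (real d * exp (- L)) +
      242 * (real m + 1)\<^sup>2 * L"
  proof -
    have "((real m + 1) * (2 * s) + 9 * ((real m + 1) * s))\<^sup>2 = 121 * (real m + 1)\<^sup>2 * s\<^sup>2"
      by (simp add: power2_eq_square algebra_simps)
    then show ?thesis
      by (simp add: power_mult_distrib s2 algebra_simps)
  qed
  also have "\<dots> \<le> (2 * (real m)\<^sup>2) * (2 + 16 * L) + (16 + 32 * L) * (real m)\<^sup>2 + 242 * (2 * real m)\<^sup>2 * L"
  \<comment> \<open>By the choice of \<open>L\<close>, \<open>exp L\<close> exceeds
    \<open>d / m\<^sup>2\<close>, so the total small-coordinate tail costs no more than
    \<open>m\<^sup>2\<close>. Since \<open>m\<close> is at least 1, \<open>m + 1\<close> is at most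
    \<open>2 * m\<close>, and also at most \<open>2 * m\<^sup>2\<close>.\<close>
  proof -
    have "exp L = 1 + real d / (real m)\<^sup>2"
      unfolding L_def using ratio by (intro exp_ln) linarith
    then have "real d / (real m)\<^sup>2 \<le> exp L"
      by simp
    then have "real d * exp (- L) \<le> (real m)\<^sup>2"
      using \<open>1 \<le> m\<close> by (simp add: exp_minus field_simps)
    moreover have "real m + 1 \<le> 2 * real m"
      using \<open>1 \<le> m\<close> by simp
    moreover from this have "real m + 1 \<le> 2 * (real m)\<^sup>2"
      using self_le_power[of "real m" 2] \<open>1 \<le> m\<close> by linarith
    ultimately show ?thesis
      using lam by (intro add_mono mult_right_mono mult_left_mono power_mono) auto
  qed
  also have "\<dots> = (real m)\<^sup>2 * (20 + 1032 * L)"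
    by (simp add: power_mult_distrib algebra_simps)
  \<comment> \<open>As \<open>L\<close> is at least 1/2, the constant 20 is at most
    \<open>40 * L\<close>.\<close>
  also have "\<dots> \<le> (real m)\<^sup>2 * (1072 * L)"
    using lam by (intro mult_left_mono) auto
  finally have "\<sigma>\<^sup>2 * (?V + ?B) \<le> \<sigma>\<^sup>2 * ((real m)\<^sup>2 * (1072 * L))"
    by (intro mult_left_mono) auto
  then show ?thesis
    unfolding risk by (intro ennreal_leI) (simp add: L_def algebra_simps)
qed

text \<open>Applied to \<open>x = d / m\<^sup>2\<close> when \<open>m\<close> exceeds the square
  root of \<open>d\<close>, to compare the risk \<open>\<sigma>\<^sup>2 * d\<close> with the
  logarithmic rate. It follows from the tangent bound for the logarithm at
  \<open>1 / (1 + x)\<close>.\<close>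

lemma half_le_ln_one_plus:
  assumes "0 \<le> x" "x \<le> (1::real)"
  shows "x / 2 \<le> ln (1 + x)"
proof -
  have "x / 2 \<le> x / (1 + x)"
    using assms by (intro divide_left_mono) auto
  also have "\<dots> = 1 - inverse (1 + x)"
    using assms by (simp add: field_simps)
  also have "\<dots> \<le> ln (1 + x)"
    using ln_le_minus_one[of "inverse (1 + x)"] assms by (simp add: ln_inverse)
  finally show ?thesis .
qed

theorem theorem3:
  fixes q :: real
  assumes "0 < q" and "q \<le> 1"
  shows "\<exists>C::real. C > 0 \<and>
    (\<forall>(d::nat) (r::real) (\<sigma>::real). d \<ge> 1 \<longrightarrow> r > 0 \<longrightarrow> \<sigma> > 0 \<longrightarrow>
      (SUP \<theta>\<in>lq_ball d q r. risk d r \<sigma> q \<theta>) \<le> ennreal (C * rate \<sigma> q r d))"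
proof (intro exI conjI allI impI SUP_least)
  fix d :: nat and r \<sigma> :: real and \<theta>
  assume r: "r > 0" and \<sigma>: "\<sigma> > 0" and \<theta>: "\<theta> \<in> lq_ball d q r"
  define m where "m = m_index d r \<sigma> q"
  consider "m = 0" | "1 \<le> m" "sqrt (real d) < real m" | "1 \<le> m" "real m \<le> sqrt (real d)"
    by linarith
  \<comment> \<open>The constant is dictated by the threshold regime; the other two need only 1 and
    2.\<close>
  then show "risk d r \<sigma> q \<theta> \<le> ennreal (1072 * rate \<sigma> q r d)"
  proof cases
    case 1
    then have "risk d r \<sigma> q \<theta> \<le> ennreal (r\<^sup>2)"
      using assms r \<theta> by (intro risk_zero_estimator) (auto simp: m_def)
    also have "\<dots> \<le> ennreal (1072 * rate \<sigma> q r d)"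
      using 1 by (intro ennreal_leI) (simp add: rate_def m_def)
    finally show ?thesis .
  next
    case 2
    have "real d \<le> (real m)\<^sup>2"
      using 2 real_less_lsqrt sqrt_le_D by (meson less_imp_le)
    then have "(real d / (real m)\<^sup>2) / 2 \<le> ln (1 + real d / (real m)\<^sup>2)"
      by (intro half_le_ln_one_plus) (auto simp: divide_le_eq)
    then have "real d \<le> 2 * (real m)\<^sup>2 * ln (1 + real d / (real m)\<^sup>2)"
      using 2 by (simp add: field_simps)
    then have "\<sigma>\<^sup>2 * real d \<le> \<sigma>\<^sup>2 * (2 * (real m)\<^sup>2 * ln (1 + real d / (real m)\<^sup>2))"
      by (intro mult_left_mono) auto
    also have "\<dots> \<le> 1072 * rate \<sigma> q r d"
      using 2 by (simp add: rate_def m_def[symmetric] Let_def)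
    finally show ?thesis
      using risk_sum_estimator[of d r \<sigma> q \<theta>] 2 by (simp add: m_def ennreal_leI)
  next
    case 3
    then show ?thesis
      using risk_threshold_estimator[OF assms r \<sigma> m_def _ _ \<theta>]
      by (simp add: rate_def m_def[symmetric] Let_def)
  qed
qed simp

end
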